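(* Let $\beta>0$ and let $x\colon[0,\infty)\to\ell^\infty_+$ be a solution to $\dot x_j=\Delta_\sigma x_j^{-\beta}$, $j\in\mathbb{Z}$, which initially has finite mean particle size $$X=\lim_{n\to\infty}X_n\in(0,\infty),\qquad X_n=\frac1{2n+1}\sum_{j=-n}^n x_j(0),$$ and let $$T_n=\inf\Big\{t>0:\ \frac1{2n+1}\sum_{\substack{j=-n,\dots,n\\ x_j(t)=0}}x_j(0)\ \ge\ \tfrac12X_n\Big\},\qquad T=\inf\Big\{t>0:\ \liminf_{n\to\infty}\frac1{2n+1}\sum_{\substack{j=-n,\dots,n\\ x_j(t)=0}}x_j(0)\ \ge\ \tfrac12X\Big\}$$ (with $\inf\emptyset=\infty$). Then there is a constant $c>0$ depending only on $\beta$ such that $\liminf_{n\to\infty}T_n\ge cX^{\beta+1}$ and $T\ge cX^{\beta+1}$.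
   Context: Let $\ell^\infty_+$ be the set of sequences $x=(x_j)_{j\in\mathbb{Z}}$ with $0\le x_j\le C$ for all $j$ and some constant $C$ depending on $x$. Convention: $0^{-\beta}=0$. For $x\in\ell^\infty_+$ and $j\in\mathbb{Z}$ put $\sigma_-(j,x)=\sup\{k<j:x_k>0\}$, $\sigma_+(j,x)=\inf\{k>j:x_k>0\}$, with $\sup\emptyset=-\infty$, $\inf\emptyset=+\infty$, $x_{\pm\infty}=0$, and $$\Delta_\sigma x_j^{-\beta}=\big(x_{\sigma_-(j,x)}^{-\beta}-2x_j^{-\beta}+x_{\sigma_+(j,x)}^{-\beta}\big)\,\chi_{\{x_j>0\}}.$$ A solution on $[0,\infty)$ of $\dot x_j=\Delta_\sigma x_j^{-\beta}$ ($j\in\mathbb{Z}$) is a map $x=(x_j)\colon[0,\infty)\to\ell^\infty_+$ such that each $x_j$ is continuous; each $x_j^{-\beta}\chi_{\{x_j>0\}}$ is locally integrable in $[0,\infty)$; and $x_j(t_2)-x_j(t_1)=\int_{t_1}^{t_2}\Delta_\sigma x_j(s)^{-\beta}\,ds$ for all $j$ and $0\le t_1<t_2<\infty$. *)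

theory Defs
  imports "HOL-Analysis.Analysis" "HOL-Library.Extended"
begin

definition ell_inf_plus :: "(int \<Rightarrow> real) set" where
  "ell_inf_plus = {y. (\<forall>j. 0 \<le> y j) \<and> (\<exists>C. \<forall>j. y j \<le> C)}"

(* Sup and Inf on int are unspecified on the empty set, so sup {} = -infinity and
   inf {} = +infinity are spelled out. *)
definition sigma_minus :: "int \<Rightarrow> (int \<Rightarrow> real) \<Rightarrow> int extended" where
  "sigma_minus j y =
     (if {k. k < j \<and> y k > 0} = {} then Minf else Fin (Sup {k. k < j \<and> y k > 0}))"

definition sigma_plus :: "int \<Rightarrow> (int \<Rightarrow> real) \<Rightarrow> int extended" where
  "sigma_plus j y =
     (if {k. k > j \<and> y k > 0} = {} then Pinf else Fin (Inf {k. k > j \<and> y k > 0}))"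

definition value_at :: "(int \<Rightarrow> real) \<Rightarrow> int extended \<Rightarrow> real" where
  "value_at y e = (case e of Fin k \<Rightarrow> y k | Pinf \<Rightarrow> 0 | Minf \<Rightarrow> 0)"

(* powr satisfies 0 powr a = 0 for every a, which is the convention 0^(-\<beta>) = 0. *)
definition Delta_sigma :: "real \<Rightarrow> (int \<Rightarrow> real) \<Rightarrow> int \<Rightarrow> real" where
  "Delta_sigma \<beta> y j =
     (value_at y (sigma_minus j y) powr (-\<beta>) - 2 * y j powr (-\<beta>)
        + value_at y (sigma_plus j y) powr (-\<beta>)) * indicat_real {k. y k > 0} j"

(* Only times t \<ge> 0 matter. The Bochner integral is 0 for non-integrable functions, so
   integrability of the right-hand side is required explicitly. In the Lebesgue sense it is
   part of the integral equation: the only negative term is integrable and the left-hand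
   side is finite. *)
definition is_solution :: "real \<Rightarrow> (real \<Rightarrow> int \<Rightarrow> real) \<Rightarrow> bool" where
  "is_solution \<beta> x \<longleftrightarrow>
     (\<forall>t\<ge>0. x t \<in> ell_inf_plus) \<and>
     (\<forall>j. continuous_on {0..} (\<lambda>t. x t j)) \<and>
     (\<forall>j. \<forall>b\<ge>0. set_integrable lborel {0..b}
            (\<lambda>t. x t j powr (-\<beta>) * indicat_real {s. x s j > 0} t)) \<and>
     (\<forall>j t1 t2. 0 \<le> t1 \<and> t1 < t2 \<longrightarrow>
        set_integrable lborel {t1..t2} (\<lambda>s. Delta_sigma \<beta> (x s) j) \<and>
        x t2 j - x t1 j = (LBINT s:{t1..t2}. Delta_sigma \<beta> (x s) j))"

definition initial_mean :: "(real \<Rightarrow> int \<Rightarrow> real) \<Rightarrow> nat \<Rightarrow> real" where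
  "initial_mean x n = 1 / (2 * real n + 1) * (\<Sum>j = - int n..int n. x 0 j)"

definition vanished_mean :: "(real \<Rightarrow> int \<Rightarrow> real) \<Rightarrow> nat \<Rightarrow> real \<Rightarrow> real" where
  "vanished_mean x n t =
     1 / (2 * real n + 1) * (\<Sum>j | j \<in> {- int n..int n} \<and> x t j = 0. x 0 j)"

definition T_fin :: "(real \<Rightarrow> int \<Rightarrow> real) \<Rightarrow> nat \<Rightarrow> ereal" where
  "T_fin x n = Inf (ereal ` {t. t > 0 \<and> vanished_mean x n t \<ge> 1 / 2 * initial_mean x n})"

definition T_lim :: "(real \<Rightarrow> int \<Rightarrow> real) \<Rightarrow> real \<Rightarrow> ereal" where
  "T_lim x X =
     Inf (ereal ` {t. t > 0 \<and> liminf (\<lambda>n. ereal (vanished_mean x n t)) \<ge> ereal (1 / 2 * X)})"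

end

(* Since x_j' \<ge> -2 x_j^(-\<beta>), a particle of initial size a needs a time of order a^(\<beta>+1) to shrink
   to a/2. Hence all particles that have vanished by time t had initial size of order at most
   t^(1/(\<beta>+1)), and so has the average of these sizes. *)
theory Submission
  imports Defs
begin

lemma Delta_sigma_ge:
  assumes "\<beta> > 0" and "m > 0" and "m \<le> y j"
  shows "- 2 * m powr (-\<beta>) \<le> Delta_sigma \<beta> y j"
proof -
  have "y j powr (-\<beta>) \<le> m powr (-\<beta>)"
    using assms by (intro powr_mono2') auto
  moreover have "Delta_sigma \<beta> y j = value_at y (sigma_minus j y) powr (-\<beta>) - 2 * y j powr (-\<beta>)
      + value_at y (sigma_plus j y) powr (-\<beta>)"
    using assms by (simp add: Delta_sigma_def)
  ultimately show ?thesis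
    using powr_ge_zero[of "value_at y (sigma_minus j y)" "-\<beta>"]
      powr_ge_zero[of "value_at y (sigma_plus j y)" "-\<beta>"]
    by linarith
qed

text \<open>The rate bound degenerates as the size tends to 0, so only the loss of the first half of
  the mass is timed: at rate at most \<open>2 * m powr (-\<beta>)\<close>, losing \<open>m\<close>
  takes time at least \<open>m powr (\<beta> + 1) / 2\<close>.\<close>

lemma vanishing_time_ge:
  assumes "\<beta> > 0" and sol: "is_solution \<beta> x" and t: "t > 0" "x t j = 0"
  shows "(x 0 j / 2) powr (\<beta> + 1) \<le> 2 * t"
proof (cases "x 0 j = 0")
  case False
  define m where "m = x 0 j / 2"
  have "x 0 j \<ge> 0"
    using sol by (auto simp: is_solution_def ell_inf_plus_def)
  with False have m: "m > 0" "x 0 j = 2 * m"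
    by (auto simp: m_def)
  have cont: "continuous_on {0..s} (\<lambda>s. x s j)" for s
    using sol by (auto simp: is_solution_def intro: continuous_on_subset)
  \<comment> \<open>The size need not be monotone in time, so the first time \<open>u\<close> at
    level \<open>m\<close> is taken; it exists because \<open>S\<close> is compact and
    nonempty.\<close>
  define S where "S = {s \<in> {0..t}. x s j = m}"
  have "\<exists>s\<ge>0. s \<le> t \<and> x s j = m"
    using IVT2'[of "\<lambda>s. x s j" t m 0] cont t m by auto
  then have "S \<noteq> {}"
    by (auto simp: S_def)
  moreover have "compact S"
  proof -
    have "closed S"
      unfolding S_def by (rule continuous_closed_preimage_constant[OF cont]) auto
    moreover have "bounded S"
      by (rule bounded_subset[of "{0..t}"]) (auto simp: S_def)
    ultimately show ?thesis
      by (simp add: compact_eq_bounded_closed)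
  qed
  ultimately obtain u where u: "u \<in> S" and min: "\<And>s. s \<in> S \<Longrightarrow> u \<le> s"
    using compact_attains_inf[of S] by metis
  then have u': "0 \<le> u" "u \<le> t" "x u j = m"
    by (auto simp: S_def)
  have "u \<noteq> 0"
    using u' m by auto
  with u' have "u > 0"
    by simp
  \<comment> \<open>A value below \<open>m\<close> at some \<open>s\<close> up to \<open>u\<close>
    would force a crossing of level \<open>m\<close> no later than \<open>s\<close>. By minimality
    of \<open>u\<close> this leaves only \<open>s = u\<close>, where the value is \<open>m\<close>
    itself.\<close>
  have ge: "m \<le> x s j" if s: "s \<in> {0..u}" for s
  proof (rule ccontr)
    assume "\<not> m \<le> x s j"
    then obtain r where r: "0 \<le> r" "r \<le> s" "x r j = m"
      using IVT2'[of "\<lambda>s. x s j" s m 0] cont s m by auto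
    then have "r \<in> S"
      using s u' by (auto simp: S_def)
    then have "s = u"
      using min r s by force
    with u' \<open>\<not> m \<le> x s j\<close> show False
      by simp
  qed
  have int: "set_integrable lborel {0..u} (\<lambda>s. Delta_sigma \<beta> (x s) j)"
    and eq: "x u j - x 0 j = (LBINT s:{0..u}. Delta_sigma \<beta> (x s) j)"
    using sol \<open>u > 0\<close> unfolding is_solution_def by blast+
  \<comment> \<open>The right-hand side is the total change over \<open>{0..u}\<close>, namely
    \<open>m - 2 * m = - m\<close>.\<close>
  have "(LBINT s:{0..u}. - 2 * m powr (-\<beta>)) \<le> (LBINT s:{0..u}. Delta_sigma \<beta> (x s) j)"
    using ge Delta_sigma_ge[OF \<open>\<beta> > 0\<close> \<open>m > 0\<close>]
    by (intro set_integral_mono int borel_integrable_atLeastAtMost') auto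
  then have "m \<le> 2 * u * m powr (-\<beta>)"
    using eq m u' by (simp add: set_lebesgue_integral_def algebra_simps)
  then have "m * m powr \<beta> \<le> 2 * u * m powr (-\<beta>) * m powr \<beta>"
    by (intro mult_right_mono) auto
  also have "\<dots> = 2 * u"
    using m by (simp add: powr_minus)
  finally show ?thesis
    using m u' by (simp add: powr_add mult.commute)
qed (use t in auto)

text \<open>Inverting \<open>vanishing_time_ge\<close> bounds each vanished particle's initial size,
  and at most \<open>2 * n + 1\<close> of them enter the average. The bound is uniform in
  \<open>n\<close>, so it survives the liminf in \<open>T_lim\<close>.\<close>

lemma vanished_mean_le:
  assumes "\<beta> > 0" and sol: "is_solution \<beta> x" and "t > 0"
  shows "vanished_mean x n t \<le> 2 * (2 * t) powr (1 / (\<beta> + 1))"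
proof -
  define M where "M = 2 * (2 * t) powr (1 / (\<beta> + 1))"
  define A where "A = {j. j \<in> {- int n..int n} \<and> x t j = 0}"
  have "x 0 j \<le> M" if "x t j = 0" for j
  proof -
    have "x 0 j \<ge> 0"
      using sol by (auto simp: is_solution_def ell_inf_plus_def)
    then have "x 0 j / 2 = ((x 0 j / 2) powr (\<beta> + 1)) powr (1 / (\<beta> + 1))"
      using \<open>\<beta> > 0\<close> by (simp add: powr_powr)
    also have "\<dots> \<le> (2 * t) powr (1 / (\<beta> + 1))"
      using vanishing_time_ge[OF assms that] \<open>\<beta> > 0\<close> by (intro powr_mono2) auto
    finally show ?thesis
      by (simp add: M_def)
  qed
  then have "(\<Sum>j\<in>A. x 0 j) \<le> of_nat (card A) * M"
    by (intro sum_bounded_above) (auto simp: A_def)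
  also have "\<dots> \<le> (2 * real n + 1) * M"
  proof (rule mult_right_mono)
    have "card A \<le> card {- int n..int n}"
      by (rule card_mono) (auto simp: A_def)
    then show "real (card A) \<le> 2 * real n + 1"
      by simp
  qed (simp add: M_def)
  finally show ?thesis
    unfolding vanished_mean_def A_def[symmetric] M_def[symmetric]
    by (simp add: field_simps)
qed

text \<open>This fixes the constant: the threshold 1/2 and the factor 2 of
  \<open>vanished_mean_le\<close> combine to 1/4, and the 2 in \<open>2 * t\<close> gives the final
  division by 2.\<close>

lemma powr_le_of_half_le:
  fixes \<beta> t Y :: real
  assumes "\<beta> > 0" and "Y \<ge> 0" and "t > 0" and "1 / 2 * Y \<le> 2 * (2 * t) powr (1 / (\<beta> + 1))"
  shows "(1 / 4) powr (\<beta> + 1) / 2 * Y powr (\<beta> + 1) \<le> t"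
proof -
  have "(1 / 4 * Y) powr (\<beta> + 1) \<le> ((2 * t) powr (1 / (\<beta> + 1))) powr (\<beta> + 1)"
    using assms by (intro powr_mono2) auto
  also have "\<dots> = 2 * t"
    using assms by (simp add: powr_powr)
  finally show ?thesis
    using assms powr_mult[of "1 / 4" Y "\<beta> + 1"] by simp
qed

theorem proposition2p4:
  fixes \<beta> :: real
  assumes "\<beta> > 0"
  shows "\<exists>c>0. \<forall>(x :: real \<Rightarrow> int \<Rightarrow> real) (X :: real).
           is_solution \<beta> x \<and> X > 0 \<and> initial_mean x \<longlonglongrightarrow> X \<longrightarrow>
             liminf (\<lambda>n. T_fin x n) \<ge> ereal (c * X powr (\<beta> + 1)) \<and>
             T_lim x X \<ge> ereal (c * X powr (\<beta> + 1))"
proof (intro exI[of _ "(1 / 4) powr (\<beta> + 1) / 2"] conjI allI impI; (elim conjE)?)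
  let ?c = "(1 / 4 :: real) powr (\<beta> + 1) / 2"
  show "?c > 0"
    by simp
  fix x :: "real \<Rightarrow> int \<Rightarrow> real" and X :: real
  assume sol: "is_solution \<beta> x" and "X > 0" and lim: "initial_mean x \<longlonglongrightarrow> X"
  have nonneg: "initial_mean x n \<ge> 0" for n
    using sol unfolding initial_mean_def is_solution_def ell_inf_plus_def
    by (intro mult_nonneg_nonneg sum_nonneg) auto
  \<comment> \<open>Each finite window obeys the bound with its own mean and the same constant, so
    letting \<open>n\<close> tend to infinity gives the claim. If no admissible time exists, the
    infimum is infinite and the bound is trivial.\<close>
  have T_fin: "ereal (?c * initial_mean x n powr (\<beta> + 1)) \<le> T_fin x n" for n
    unfolding T_fin_def
  proof (intro Inf_greatest, elim imageE CollectE conjE)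
    fix z t
    assume z: "z = ereal t" and "t > 0" and ge: "1 / 2 * initial_mean x n \<le> vanished_mean x n t"
    note ge
    also note vanished_mean_le[OF \<open>\<beta> > 0\<close> sol \<open>t > 0\<close>]
    finally show "ereal (?c * initial_mean x n powr (\<beta> + 1)) \<le> z"
      using powr_le_of_half_le[OF \<open>\<beta> > 0\<close> nonneg \<open>t > 0\<close>] z by simp
  qed
  have "(\<lambda>n. ereal (?c * initial_mean x n powr (\<beta> + 1))) \<longlonglongrightarrow> ereal (?c * X powr (\<beta> + 1))"
    using \<open>X > 0\<close> by (intro tendsto_intros lim) auto
  then have "ereal (?c * X powr (\<beta> + 1))
      = liminf (\<lambda>n. ereal (?c * initial_mean x n powr (\<beta> + 1)))"
    by (intro lim_imp_Liminf[symmetric] sequentially_bot)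
  also have "\<dots> \<le> liminf (\<lambda>n. T_fin x n)"
    by (intro Liminf_mono always_eventually allI T_fin)
  finally show "ereal (?c * X powr (\<beta> + 1)) \<le> liminf (\<lambda>n. T_fin x n)" .
  show "ereal (?c * X powr (\<beta> + 1)) \<le> T_lim x X"
    unfolding T_lim_def
  proof (intro Inf_greatest, elim imageE CollectE conjE)
    fix z t
    assume z: "z = ereal t" and "t > 0"
      and ge: "liminf (\<lambda>n. ereal (vanished_mean x n t)) \<ge> ereal (1 / 2 * X)"
    \<comment> \<open>Here the limit in \<open>n\<close> is taken at the fixed time
      \<open>t\<close>, before solving for \<open>t\<close>.\<close>
    note ge
    also have "liminf (\<lambda>n. ereal (vanished_mean x n t))
        \<le> liminf (\<lambda>n. ereal (2 * (2 * t) powr (1 / (\<beta> + 1))))"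
      using vanished_mean_le[OF \<open>\<beta> > 0\<close> sol \<open>t > 0\<close>]
      by (intro Liminf_mono always_eventually) auto
    also have "\<dots> = ereal (2 * (2 * t) powr (1 / (\<beta> + 1)))"
      by (simp add: Liminf_const)
    finally show "ereal (?c * X powr (\<beta> + 1)) \<le> z"
      using powr_le_of_half_le[OF \<open>\<beta> > 0\<close> _ \<open>t > 0\<close>, of X] \<open>X > 0\<close> z by simp
  qed
qed

end
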